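(* Let $n\ge 2$. If $m\in \{1,\dots,n-1\}$ and $A$ is a Borel set contained in an $m$-dimensional plane in $\mathbb{R}^n$, then $$\mathcal{H}^m(A)^2= \frac{1}{n-m}\sum_{i=1}^n\mathcal{H}^m(A|e_i^{\perp})^2.$$
   Context: $\mathcal{H}^m$ is $m$-dimensional Hausdorff measure in $\mathbb{R}^n$ (normalized to agree with Lebesgue measure on $m$-dimensional planes). $e_1,\dots,e_n$ is the standard orthonormal basis of $\mathbb{R}^n$, $e_i^\perp$ is the $i$th coordinate hyperplane, and $A|e_i^\perp$ is the orthogonal projection of $A$ on $e_i^\perp$. "Plane" means affine subspace. *)

theory Defs
  imports "HOL-Analysis.Analysis"
begin

text \<open>
  Hausdorff measure is taken as an outer measure, defined on all sets and with values in
  \<^typ>\<open>ennreal\<close>. The factor \<^term>\<open>unit_ball_vol (real m) / 2 ^ m\<close> (a set is weighted by the volume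
  of the \<^term>\<open>m\<close>-dimensional ball with the same diameter) is the normalization under which the
  measure agrees with Lebesgue measure on \<^term>\<open>m\<close>-dimensional planes. The library's
  \<^const>\<open>diameter\<close> is meaningful on bounded sets only, hence the boundedness condition on covers.
  The empty set is given weight 0 explicitly, since \<^prop>\<open>(0::real) ^ 0 = 1\<close>.
\<close>

definition hausdorff_weight :: "nat \<Rightarrow> 'a::metric_space set \<Rightarrow> ennreal" where
  "hausdorff_weight m U =
     (if U = {} then 0 else ennreal (unit_ball_vol (real m) * (diameter U / 2) ^ m))"

definition hausdorff_premeasure :: "nat \<Rightarrow> real \<Rightarrow> 'a::metric_space set \<Rightarrow> ennreal" where
  "hausdorff_premeasure m \<delta> A =
     (INF U \<in> {U :: nat \<Rightarrow> 'a set. A \<subseteq> (\<Union>k. U k) \<and> (\<forall>k. bounded (U k) \<and> diameter (U k) \<le> \<delta>)}.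
        \<Sum>k. hausdorff_weight m (U k))"

definition hausdorff_measure :: "nat \<Rightarrow> 'a::metric_space set \<Rightarrow> ennreal" where
  "hausdorff_measure m A = (SUP \<delta> \<in> {0<..}. hausdorff_premeasure m \<delta> A)"

definition coord_hyperplane :: "'n \<Rightarrow> (real ^ 'n::finite) set" where
  "coord_hyperplane i = {y. y \<bullet> axis i 1 = 0}"

definition coord_proj :: "'n \<Rightarrow> real ^ 'n \<Rightarrow> real ^ 'n::finite" where
  "coord_proj i x = x - (x \<bullet> axis i 1) *\<^sub>R axis i 1"

lemma coord_proj_orthogonal_projection:
  "y = coord_proj i x \<longleftrightarrow>
     y \<in> coord_hyperplane i \<and> (\<forall>z \<in> coord_hyperplane i. orthogonal (x - y) z)"
proof
  assume "y = coord_proj i x"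
  then show "y \<in> coord_hyperplane i \<and> (\<forall>z \<in> coord_hyperplane i. orthogonal (x - y) z)"
    by (auto simp: coord_proj_def coord_hyperplane_def orthogonal_def inner_diff_left
        inner_axis_axis inner_commute[of "axis i 1"])
next
  assume y: "y \<in> coord_hyperplane i \<and> (\<forall>z \<in> coord_hyperplane i. orthogonal (x - y) z)"
  define d where "d = coord_proj i x - y"
  have d: "d \<in> coord_hyperplane i"
    using y by (simp add: d_def coord_proj_def coord_hyperplane_def inner_diff_left inner_axis_axis)
  then have "(x - y) \<bullet> d = 0" "axis i 1 \<bullet> d = 0"
    using y by (auto simp: orthogonal_def coord_hyperplane_def inner_commute)
  then have "d \<bullet> d = 0"
    by (simp add: d_def coord_proj_def inner_diff_left)
  then show "y = coord_proj i x"
    by (simp add: d_def)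
qed

end

theory Submission
  imports Defs
begin

text \<open>
  Translating, assume that the plane is a linear subspace \<open>V\<close>. Let \<open>w\<close> be the orthogonal projection of
  \<open>e\<^sub>i\<close> on \<open>V\<close>. On \<open>V\<close>, the projection on \<open>e\<^sub>i\<^sup>\<bottom>\<close> is, up to an isometry, the map
  scaling the direction of \<open>w\<close> by \<open>sqrt (1 - |w|\<^sup>2)\<close>, so it multiplies \<open>m\<close>-dimensional measure by this
  number. The squares of these factors add up to \<open>n - m\<close>, because the \<open>|w|\<^sup>2\<close> add up to the trace of the
  orthogonal projection on \<open>V\<close>.

  That a scaling by \<open>s\<close> in one direction multiplies Hausdorff measure on \<open>V\<close> by \<open>s\<close> needs no comparison
  with Lebesgue measure. Translation invariant measures on \<open>V\<close> are proportional, which gives some factor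
  \<open>c\<close>; by symmetry it is the same in all directions; and scaling all \<open>m\<close> directions of an orthonormal basis
  is a homothety, so \<open>c ^ m = s ^ m\<close>.
\<close>

section \<open>Hausdorff measure as an outer measure\<close>

lemma hausdorff_weight_empty [simp]: "hausdorff_weight m {} = 0"
  by (simp add: hausdorff_weight_def)

lemma hausdorff_premeasure_le:
  assumes "A \<subseteq> (\<Union>k. U k)" "\<And>k. bounded (U k)" "\<And>k. diameter (U k) \<le> \<delta>"
  shows "hausdorff_premeasure m \<delta> A \<le> (\<Sum>k. hausdorff_weight m (U k))"
  unfolding hausdorff_premeasure_def using assms by (intro INF_lower) auto

lemma hausdorff_premeasure_empty [simp]: "\<delta> \<ge> 0 \<Longrightarrow> hausdorff_premeasure m \<delta> {} = 0"
  using hausdorff_premeasure_le[of "{}" "\<lambda>_. {}" \<delta> m] by simp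

lemma hausdorff_premeasure_mono:
  "A \<subseteq> B \<Longrightarrow> hausdorff_premeasure m \<delta> A \<le> hausdorff_premeasure m \<delta> B"
  unfolding hausdorff_premeasure_def by (intro INF_superset_mono) auto

lemma hausdorff_premeasure_antimono:
  "\<delta> \<le> \<epsilon> \<Longrightarrow> hausdorff_premeasure m \<epsilon> A \<le> hausdorff_premeasure m \<delta> A"
  unfolding hausdorff_premeasure_def by (intro INF_superset_mono) (auto intro: order_trans)

lemma hausdorff_premeasure_le_weight:
  assumes "bounded A" "diameter A \<le> \<delta>" "\<delta> \<ge> 0"
  shows "hausdorff_premeasure m \<delta> A \<le> hausdorff_weight m A"
proof -
  define U where "U k = (if k = 0 then A else {})" for k :: nat
  have "hausdorff_premeasure m \<delta> A \<le> (\<Sum>k. hausdorff_weight m (U k))"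
    by (rule hausdorff_premeasure_le) (use assms in \<open>auto simp: U_def\<close>)
  also have "\<dots> = (\<Sum>k\<in>{0}. hausdorff_weight m (U k))"
    by (rule suminf_finite) (auto simp: U_def)
  finally show ?thesis by (simp add: U_def)
qed

text \<open>Covers of the single \<open>A i\<close>, each optimal up to a share of \<open>e\<close>
  that halves with \<open>i\<close>, are merged into one sequence through the enumeration
  \<open>prod_decode\<close> of pairs.\<close>

lemma hausdorff_premeasure_UN_le:
  "hausdorff_premeasure m \<delta> (\<Union>i. A i) \<le> (\<Sum>i. hausdorff_premeasure m \<delta> (A i))"
proof (rule ennreal_le_epsilon)
  fix e :: real
  assume fin: "(\<Sum>i. hausdorff_premeasure m \<delta> (A i)) < top" and e: "0 < e"
  have "\<exists>U. A i \<subseteq> (\<Union>k. U k) \<and> (\<forall>k. bounded (U k) \<and> diameter (U k) \<le> \<delta>) \<and>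
          (\<Sum>k. hausdorff_weight m (U k)) \<le> hausdorff_premeasure m \<delta> (A i) + e * (1/2) ^ Suc i" for i
  proof -
    \<comment> \<open>Finiteness makes the next inequality strict, and strictness is what yields a
      cover from the infimum.\<close>
    have "hausdorff_premeasure m \<delta> (A i) < top"
      using fin by (metis ennreal_suminf_lessD)
    then have "hausdorff_premeasure m \<delta> (A i) < hausdorff_premeasure m \<delta> (A i) + e * (1/2) ^ Suc i"
      using e by (auto simp: less_top)
    from this[unfolded hausdorff_premeasure_def INF_less_iff, folded hausdorff_premeasure_def]
    show ?thesis by (auto dest: less_imp_le)
  qed
  then obtain U where U: "\<And>i. A i \<subseteq> (\<Union>k. U i k)" "\<And>i k. bounded (U i k)"
      "\<And>i k. diameter (U i k) \<le> \<delta>"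
      "\<And>i. (\<Sum>k. hausdorff_weight m (U i k)) \<le> hausdorff_premeasure m \<delta> (A i) + e * (1/2) ^ Suc i"
    by metis
  define W where "W = (\<lambda>n. case prod_decode n of (i, k) \<Rightarrow> U i k)"
  have "(\<Union>i. A i) \<subseteq> (\<Union>n. W n)"
  proof
    fix x assume "x \<in> (\<Union>i. A i)"
    then obtain i k where "x \<in> U i k" using U(1) by blast
    then have "x \<in> W (prod_encode (i, k))" by (simp add: W_def)
    then show "x \<in> (\<Union>n. W n)" by blast
  qed
  then have "hausdorff_premeasure m \<delta> (\<Union>i. A i) \<le> (\<Sum>n. hausdorff_weight m (W n))"
    by (rule hausdorff_premeasure_le) (auto simp: W_def U split: prod.split)
  also have "\<dots> = (\<Sum>n. (\<lambda>(i, k). hausdorff_weight m (U i k)) (prod_decode n))"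
    by (simp add: W_def prod.case_distrib)
  also have "\<dots> = (\<Sum>i. \<Sum>k. hausdorff_weight m (U i k))"
    by (rule suminf_ennreal_2dimen) simp
  also have "\<dots> \<le> (\<Sum>i. hausdorff_premeasure m \<delta> (A i) + e * (1/2) ^ Suc i)"
    by (intro suminf_le U) auto
  also have "\<dots> = (\<Sum>i. hausdorff_premeasure m \<delta> (A i)) + (\<Sum>i. ennreal e * ennreal ((1/2) ^ Suc i))"
    using e by (subst suminf_add[symmetric])
      (auto simp del: ennreal_suminf_cmult simp add: ennreal_mult[symmetric])
  also have "\<dots> = (\<Sum>i. hausdorff_premeasure m \<delta> (A i)) + e"
    unfolding ennreal_suminf_cmult
    by (subst suminf_ennreal_eq[OF zero_le_power power_half_series]) auto
  finally show "hausdorff_premeasure m \<delta> (\<Union>i. A i) \<le> (\<Sum>i. hausdorff_premeasure m \<delta> (A i)) + e" .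
qed

lemma hausdorff_premeasure_le_measure:
  "0 < \<delta> \<Longrightarrow> hausdorff_premeasure m \<delta> A \<le> hausdorff_measure m A"
  unfolding hausdorff_measure_def by (rule SUP_upper) simp

lemma hausdorff_measure_empty [simp]: "hausdorff_measure m {} = 0"
  by (simp add: hausdorff_measure_def)

lemma hausdorff_measure_mono:
  "A \<subseteq> B \<Longrightarrow> hausdorff_measure m A \<le> hausdorff_measure m B"
  unfolding hausdorff_measure_def by (intro SUP_mono') (rule hausdorff_premeasure_mono)

lemma hausdorff_measure_UN_le:
  "hausdorff_measure m (\<Union>i. A i) \<le> (\<Sum>i. hausdorff_measure m (A i))"
  unfolding hausdorff_measure_def[of m "\<Union>i. A i"]
proof (rule SUP_least)
  fix \<delta> :: real assume "\<delta> \<in> {0<..}"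
  then have "(\<Sum>i. hausdorff_premeasure m \<delta> (A i)) \<le> (\<Sum>i. hausdorff_measure m (A i))"
    by (intro suminf_le hausdorff_premeasure_le_measure) auto
  then show "hausdorff_premeasure m \<delta> (\<Union>i. A i) \<le> (\<Sum>i. hausdorff_measure m (A i))"
    using hausdorff_premeasure_UN_le order_trans by blast
qed

lemma hausdorff_premeasure_Un_le:
  assumes "\<delta> \<ge> 0"
  shows "hausdorff_premeasure m \<delta> (A \<union> B) \<le> hausdorff_premeasure m \<delta> A + hausdorff_premeasure m \<delta> B"
proof -
  have "hausdorff_premeasure m \<delta> (\<Union>i. binaryset A B i) \<le> (\<Sum>i. hausdorff_premeasure m \<delta> (binaryset A B i))"
    by (rule hausdorff_premeasure_UN_le)
  also have "\<dots> = hausdorff_premeasure m \<delta> A + hausdorff_premeasure m \<delta> B"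
    by (rule suminf_binaryset_eq) (simp add: assms)
  finally show ?thesis by (simp add: UN_binaryset_eq)
qed

lemma hausdorff_measure_Un_le:
  "hausdorff_measure m (A \<union> B) \<le> hausdorff_measure m A + hausdorff_measure m B"
proof -
  have "hausdorff_measure m (\<Union>i. binaryset A B i) \<le> (\<Sum>i. hausdorff_measure m (binaryset A B i))"
    by (rule hausdorff_measure_UN_le)
  also have "\<dots> = hausdorff_measure m A + hausdorff_measure m B"
    by (rule suminf_binaryset_eq) simp
  finally show ?thesis by (simp add: UN_binaryset_eq)
qed

text \<open>Covers in the definition are sequences; this form accepts any finite index set, such as
  the cells of a grid.\<close>

lemma hausdorff_premeasure_finite_cover:
  assumes "finite I" "A \<subseteq> (\<Union>i\<in>I. U i)" "\<And>i. i \<in> I \<Longrightarrow> bounded (U i)"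
    "\<And>i. i \<in> I \<Longrightarrow> diameter (U i) \<le> \<delta>" "\<delta> \<ge> 0"
  shows "hausdorff_premeasure m \<delta> A \<le> (\<Sum>i\<in>I. hausdorff_weight m (U i))"
  using assms
proof (induction I arbitrary: A rule: finite_induct)
  case empty
  then show ?case by simp
next
  case (insert i I)
  have "hausdorff_premeasure m \<delta> A \<le> hausdorff_premeasure m \<delta> (U i \<union> (A - U i))"
    by (rule hausdorff_premeasure_mono) auto
  also have "\<dots> \<le> hausdorff_premeasure m \<delta> (U i) + hausdorff_premeasure m \<delta> (A - U i)"
    by (rule hausdorff_premeasure_Un_le) fact
  also have "\<dots> \<le> hausdorff_weight m (U i) + (\<Sum>i\<in>I. hausdorff_weight m (U i))"
    using insert.prems by (intro add_mono hausdorff_premeasure_le_weight insert.IH) auto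
  finally show ?case using insert.hyps by simp
qed

section \<open>Lipschitz images, isometries and homotheties\<close>

lemma hausdorff_measure_lipschitz_image:
  fixes f :: "'a::metric_space \<Rightarrow> 'b::metric_space"
  assumes lip: "\<And>x y. x \<in> A \<Longrightarrow> y \<in> A \<Longrightarrow> dist (f x) (f y) \<le> K * dist x y" and K: "0 < K"
  shows "hausdorff_measure m (f ` A) \<le> ennreal (K ^ m) * hausdorff_measure m A"
  unfolding hausdorff_measure_def[of m "f ` A"]
proof (rule SUP_least)
  fix \<delta> :: real assume "\<delta> \<in> {0<..}"
  then have \<delta>: "0 < \<delta>" by simp
  \<comment> \<open>A cover of \<open>A\<close> at scale \<open>\<delta> / K\<close> is pushed
    forward to a cover of the image at scale \<open>\<delta>\<close>. Each diameter grows at most by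
    \<open>K\<close>, hence each weight at most by \<open>K ^ m\<close>. The pieces are cut down to
    \<open>A\<close> first because \<open>f\<close> is Lipschitz only there.\<close>
  have "hausdorff_premeasure m \<delta> (f ` A) \<le> ennreal (K ^ m) * (\<Sum>k. hausdorff_weight m (U k))"
    if U: "A \<subseteq> (\<Union>k. U k)" "\<And>k. bounded (U k)" "\<And>k. diameter (U k) \<le> \<delta> / K" for U :: "nat \<Rightarrow> 'a set"
  proof -
    define W where "W k = f ` (U k \<inter> A)" for k
    have dist_W: "dist x y \<le> K * diameter (U k)" if xy: "x \<in> W k" "y \<in> W k" for x y k
    proof -
      obtain a b where ab: "a \<in> U k" "a \<in> A" "b \<in> U k" "b \<in> A" "x = f a" "y = f b"
        using xy by (auto simp: W_def)
      have "dist x y \<le> K * dist a b" using lip ab by simp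
      also have "\<dots> \<le> K * diameter (U k)"
        using K ab U(2) by (intro mult_left_mono diameter_bounded_bound) auto
      finally show ?thesis .
    qed
    have bnd: "bounded (W k)" for k
    proof (cases "W k = {}")
      case False
      then obtain x where "x \<in> W k" by auto
      then show ?thesis unfolding bounded_def using dist_W by blast
    qed auto
    have diam: "diameter (W k) \<le> K * diameter (U k)" for k
    proof (cases "W k = {}")
      case True
      then show ?thesis using K diameter_ge_0[OF U(2)] by simp
    next
      case False
      then show ?thesis unfolding diameter_def[of "W k"]
        using dist_W by (auto intro!: cSUP_least)
    qed
    have "hausdorff_premeasure m \<delta> (f ` A) \<le> (\<Sum>k. hausdorff_weight m (W k))"
    proof (rule hausdorff_premeasure_le)
      show "f ` A \<subseteq> (\<Union>k. W k)" using U(1) by (fastforce simp: W_def)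
      show "diameter (W k) \<le> \<delta>" for k
        using order_trans[OF diam mult_left_mono[OF U(3)]] K by simp
    qed (rule bnd)
    also have "\<dots> \<le> (\<Sum>k. ennreal (K ^ m) * hausdorff_weight m (U k))"
    proof (intro suminf_le)
      fix k
      have "(diameter (W k) / 2) ^ m \<le> (K * diameter (U k) / 2) ^ m"
        using diam[of k] bnd diameter_ge_0 by (intro power_mono) (auto simp: divide_right_mono)
      then have "unit_ball_vol (real m) * (diameter (W k) / 2) ^ m \<le>
          K ^ m * (unit_ball_vol (real m) * (diameter (U k) / 2) ^ m)"
        using mult_left_mono[of _ _ "unit_ball_vol (real m)"]
        by (fastforce simp: power_mult_distrib power_divide mult_ac)
      then show "hausdorff_weight m (W k) \<le> ennreal (K ^ m) * hausdorff_weight m (U k)"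
        using K U(2)
        by (auto simp: hausdorff_weight_def W_def ennreal_mult'[symmetric] intro!: ennreal_leI)
    qed auto
    finally show ?thesis by simp
  qed
  \<comment> \<open>After division by the constant, the bound valid for every cover becomes a lower
    bound of the infimum over covers.\<close>
  then have "hausdorff_premeasure m \<delta> (f ` A) / ennreal (K ^ m) \<le> hausdorff_premeasure m (\<delta> / K) A"
    using K unfolding hausdorff_premeasure_def[of m "\<delta> / K"]
    by (intro INF_greatest divide_le_posI_ennreal) (auto simp: mult.commute)
  also have "\<dots> \<le> hausdorff_measure m A"
    by (rule hausdorff_premeasure_le_measure) (use \<delta> K in auto)
  finally show "hausdorff_premeasure m \<delta> (f ` A) \<le> ennreal (K ^ m) * hausdorff_measure m A"
    using K mult_left_mono[of _ _ "ennreal (K ^ m)"]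
    by (fastforce simp: ennreal_times_divide mult_divide_eq_ennreal mult.commute[of "ennreal (K ^ m)"])
qed

text \<open>The assignment sending \<open>f x\<close> to \<open>g x\<close> is well defined, since
  \<open>f x = f y\<close> forces \<open>g x = g y\<close>, and it is 1-Lipschitz. Two images of one
  set can thus be compared without an explicit map between them.\<close>

lemma hausdorff_measure_image_le_image:
  fixes f :: "'c \<Rightarrow> 'a::metric_space" and g :: "'c \<Rightarrow> 'b::metric_space"
  assumes "\<And>x y. x \<in> A \<Longrightarrow> y \<in> A \<Longrightarrow> dist (g x) (g y) \<le> dist (f x) (f y)"
  shows "hausdorff_measure m (g ` A) \<le> hausdorff_measure m (f ` A)"
proof -
  define h where "h z = g (SOME x. x \<in> A \<and> f x = z)" for z
  have h: "h (f x) = g x" if "x \<in> A" for x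
  proof -
    have "(SOME y. y \<in> A \<and> f y = f x) \<in> A \<and> f (SOME y. y \<in> A \<and> f y = f x) = f x"
      by (rule someI[of _ x]) (use that in simp)
    then have "dist (h (f x)) (g x) \<le> 0"
      using assms[OF _ that] by (fastforce simp: h_def)
    then show ?thesis by simp
  qed
  have "hausdorff_measure m (h ` f ` A) \<le> ennreal (1 ^ m) * hausdorff_measure m (f ` A)"
    by (rule hausdorff_measure_lipschitz_image) (use h assms in auto)
  also have "h ` f ` A = g ` A" using h by (force simp: image_image)
  finally show ?thesis by simp
qed

lemma hausdorff_measure_image_eq:
  assumes "\<And>x y. x \<in> A \<Longrightarrow> y \<in> A \<Longrightarrow> dist (g x) (g y) = dist (f x) (f y)"
  shows "hausdorff_measure m (g ` A) = hausdorff_measure m (f ` A)"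
  by (intro antisym hausdorff_measure_image_le_image) (simp_all add: assms)

lemma hausdorff_measure_isometric_image:
  assumes "\<And>x y. x \<in> A \<Longrightarrow> y \<in> A \<Longrightarrow> dist (f x) (f y) = dist x y"
  shows "hausdorff_measure m (f ` A) = hausdorff_measure m A"
  using hausdorff_measure_image_eq[of A f id] assms by simp

text \<open>One bound is the Lipschitz estimate for the homothety, the other is the same estimate
  for its inverse.\<close>

lemma hausdorff_measure_scaleR:
  fixes A :: "'a::real_normed_vector set"
  assumes "0 < c"
  shows "hausdorff_measure m ((*\<^sub>R) c ` A) = ennreal (c ^ m) * hausdorff_measure m A"
proof (rule antisym)
  show "hausdorff_measure m ((*\<^sub>R) c ` A) \<le> ennreal (c ^ m) * hausdorff_measure m A"
    by (rule hausdorff_measure_lipschitz_image) (use assms in \<open>auto simp: dist_norm simp flip: scaleR_diff_right\<close>)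
  have "hausdorff_measure m ((*\<^sub>R) (1/c) ` (*\<^sub>R) c ` A) \<le> ennreal ((1/c) ^ m) * hausdorff_measure m ((*\<^sub>R) c ` A)"
    by (rule hausdorff_measure_lipschitz_image) (use assms in \<open>auto simp: dist_norm simp flip: scaleR_diff_right\<close>)
  then have "hausdorff_measure m A \<le> ennreal ((1/c) ^ m) * hausdorff_measure m ((*\<^sub>R) c ` A)"
    using assms by (simp add: image_image)
  then have "ennreal (c ^ m) * hausdorff_measure m A \<le>
      ennreal (c ^ m) * (ennreal ((1/c) ^ m) * hausdorff_measure m ((*\<^sub>R) c ` A))"
    by (rule mult_left_mono) simp
  also have "\<dots> = hausdorff_measure m ((*\<^sub>R) c ` A)"
    using assms by (simp add: mult.assoc[symmetric] ennreal_mult'[symmetric] power_mult_distrib[symmetric])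
  finally show "ennreal (c ^ m) * hausdorff_measure m A \<le> hausdorff_measure m ((*\<^sub>R) c ` A)" .
qed

text \<open>A set of diameter below \<open>d\<close> cannot meet both \<open>A\<close> and
  \<open>B\<close>, so every fine cover of the union splits into a cover of \<open>A\<close> and a
  cover of \<open>B\<close>.\<close>

lemma hausdorff_measure_separated:
  assumes "0 < d" "\<And>x y. x \<in> A \<Longrightarrow> y \<in> B \<Longrightarrow> d \<le> dist x y"
  shows "hausdorff_measure m A + hausdorff_measure m B \<le> hausdorff_measure m (A \<union> B)"
proof -
  have *: "hausdorff_premeasure m \<delta> A + hausdorff_premeasure m \<delta> B \<le> hausdorff_premeasure m \<delta> (A \<union> B)"
    if \<delta>: "\<delta> < d" "0 < \<delta>" for \<delta>
    unfolding hausdorff_premeasure_def[of m \<delta> "A \<union> B"]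
  proof (rule INF_greatest, clarify)
    fix U :: "nat \<Rightarrow> 'a set"
    assume U: "A \<union> B \<subseteq> (\<Union>k. U k)" "\<forall>k. bounded (U k) \<and> diameter (U k) \<le> \<delta>"
    define V W where "V k = (if U k \<inter> A = {} then {} else U k)"
      and "W k = (if U k \<inter> A = {} then U k else {})" for k
    have no: "U k \<inter> B = {}" if "U k \<inter> A \<noteq> {}" for k
    proof (rule ccontr)
      assume "U k \<inter> B \<noteq> {}"
      then obtain x y where "x \<in> U k" "x \<in> A" "y \<in> U k" "y \<in> B" using \<open>U k \<inter> A \<noteq> {}\<close> by auto
      then have "d \<le> dist x y" "dist x y \<le> diameter (U k)"
        using assms(2) U(2) by (auto intro: diameter_bounded_bound)
      then show False using U(2) \<delta> by (metis not_less order_trans)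
    qed
    have "hausdorff_premeasure m \<delta> A \<le> (\<Sum>k. hausdorff_weight m (V k))"
      by (rule hausdorff_premeasure_le) (use U \<delta> in \<open>auto simp: V_def subset_iff; blast\<close>)+
    moreover have "hausdorff_premeasure m \<delta> B \<le> (\<Sum>k. hausdorff_weight m (W k))"
    proof (rule hausdorff_premeasure_le)
      show "B \<subseteq> (\<Union>k. W k)"
      proof
        fix x assume x: "x \<in> B"
        then obtain k where k: "x \<in> U k" using U by auto
        then have "x \<in> W k" using no[of k] x by (auto simp: W_def)
        then show "x \<in> (\<Union>k. W k)" by blast
      qed
    qed (use U \<delta> in \<open>auto simp: W_def\<close>)
    ultimately have "hausdorff_premeasure m \<delta> A + hausdorff_premeasure m \<delta> B \<le>
        (\<Sum>k. hausdorff_weight m (V k)) + (\<Sum>k. hausdorff_weight m (W k))"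
      by (rule add_mono)
    also have "\<dots> = (\<Sum>k. hausdorff_weight m (V k) + hausdorff_weight m (W k))"
      by (rule suminf_add) auto
    also have "(\<lambda>k. hausdorff_weight m (V k) + hausdorff_weight m (W k)) = (\<lambda>k. hausdorff_weight m (U k))"
      by (auto simp: V_def W_def)
    finally show "hausdorff_premeasure m \<delta> A + hausdorff_premeasure m \<delta> B \<le> (\<Sum>k. hausdorff_weight m (U k))" .
  qed
  have **: "hausdorff_premeasure m \<delta> A + hausdorff_premeasure m \<epsilon> B \<le> hausdorff_measure m (A \<union> B)"
    if "0 < \<delta>" "0 < \<epsilon>" for \<delta> \<epsilon>
  proof -
    \<comment> \<open>Premeasures grow as the scale shrinks, so two scales may be replaced by a
      common smaller one; \<open>d / 2\<close> keeps it strictly below \<open>d\<close>.\<close>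
    define \<gamma> where "\<gamma> = Min {\<delta>, \<epsilon>, d / 2}"
    have \<gamma>: "0 < \<gamma>" "\<gamma> \<le> \<delta>" "\<gamma> \<le> \<epsilon>" "\<gamma> < d" using that assms(1) by (auto simp: \<gamma>_def min_def)
    have "hausdorff_premeasure m \<delta> A + hausdorff_premeasure m \<epsilon> B \<le>
        hausdorff_premeasure m \<gamma> A + hausdorff_premeasure m \<gamma> B"
      using \<gamma> by (intro add_mono hausdorff_premeasure_antimono)
    also have "\<dots> \<le> hausdorff_premeasure m \<gamma> (A \<union> B)" using \<gamma> by (intro *)
    also have "\<dots> \<le> hausdorff_measure m (A \<union> B)" using \<gamma> by (intro hausdorff_premeasure_le_measure)
    finally show ?thesis .
  qed
  have ne: "{0<..} \<noteq> ({}::real set)" by auto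
  have "hausdorff_measure m A + hausdorff_measure m B =
      (SUP \<delta>\<in>{0<..}. SUP \<epsilon>\<in>{0<..}. hausdorff_premeasure m \<delta> A + hausdorff_premeasure m \<epsilon> B)"
    unfolding hausdorff_measure_def
    by (simp add: ennreal_SUP_add_left[OF ne, symmetric] ennreal_SUP_add_right[OF ne, symmetric])
  also have "\<dots> \<le> hausdorff_measure m (A \<union> B)"
    by (intro SUP_least **) auto
  finally show ?thesis .
qed

section \<open>Borel sets are measurable\<close>

lemma hausdorff_measure_outer:
  "outer_measure_space UNIV (hausdorff_measure m)"
  unfolding outer_measure_space_def positive_def increasing_def countably_subadditive_def
  by (auto intro: hausdorff_measure_mono hausdorff_measure_UN_le)

lemma ennreal_suminf_tail_small:
  fixes f :: "nat \<Rightarrow> ennreal"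
  assumes "(\<Sum>k. f k) \<noteq> top" "0 < e"
  obtains n where "(\<Sum>k. f (k + n)) \<le> ennreal e"
proof -
  have fin: "f k = ennreal (enn2real (f k))" for k
    using assms(1) ennreal_suminf_lessD[of f top] by (simp add: less_top)
  have "(\<Sum>k. ennreal (enn2real (f k))) \<noteq> top"
    using assms(1) fin by simp
  then have sm: "summable (\<lambda>k. enn2real (f k))"
    by (intro summable_suminf_not_top) auto
  obtain n where n: "norm (\<Sum>k. enn2real (f (k + n))) < e"
    using suminf_exist_split[OF assms(2) sm] by blast
  have "(\<Sum>k. f (k + n)) = (\<Sum>k. ennreal (enn2real (f (k + n))))"
    using fin by simp
  also have "\<dots> = ennreal (\<Sum>k. enn2real (f (k + n)))"
    using sm by (intro suminf_ennreal2) (auto intro: summable_ignore_initial_segment)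
  also have "\<dots> \<le> ennreal e" using n by (intro ennreal_leI) auto
  finally show ?thesis using that by blast
qed

text \<open>The classical argument for metric outer measures: the shells \<open>R k\<close> of points of \<open>X\<close> at distance
  about \<open>1 / k\<close> from \<open>C\<close> are pairwise separated as soon as their indices differ by at least 2, so
  their measures are summable and the points of \<open>X\<close> close to \<open>C\<close> but outside it are negligible.\<close>

lemma hausdorff_measure_caratheodory_closed:
  fixes C X :: "'a::metric_space set"
  assumes "closed C" "C \<noteq> {}"
  shows "hausdorff_measure m (X \<inter> C) + hausdorff_measure m (X - C) \<le> hausdorff_measure m X"
proof (cases "hausdorff_measure m X = top")
  case fin: False
  define Y where "Y k = {x \<in> X. inverse (real (Suc k)) \<le> infdist x C}" for k
  define R where "R k = {x \<in> X. inverse (real (Suc (Suc k))) \<le> infdist x C \<and> infdist x C < inverse (real (Suc k))}" for k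
  let ?H = "hausdorff_measure m"
  have inv_mono: "inverse (real j) \<le> inverse (real k)" if "k \<le> j" "0 < k" for j k
    using that by (simp add: field_simps)
  have sep: "a - b \<le> dist x y" if "a \<le> infdist x C" "infdist y C \<le> b" for a b x y
    using that infdist_triangle[of x C y] by simp
  have sum_R: "(\<Sum>i<N. ?H (R (2 * i + p))) \<le> ?H (\<Union>i<N. R (2 * i + p))" for N p
  proof (induction N)
    case (Suc N)
    have "?H (\<Union>i<N. R (2 * i + p)) + ?H (R (2 * N + p)) \<le> ?H ((\<Union>i<N. R (2 * i + p)) \<union> R (2 * N + p))"
    \<comment> \<open>For \<open>N = 0\<close> the union is empty. The gap used otherwise would fail
      there when \<open>p = 0\<close>, because \<open>inverse 0 = 0\<close>.\<close>
    proof (cases "N = 0")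
      case False
      show ?thesis
      proof (rule hausdorff_measure_separated)
        show "0 < inverse (real (2 * N + p)) - inverse (real (Suc (2 * N + p)))"
          using False less_imp_inverse_less[of "real (2 * N + p)" "real (Suc (2 * N + p))"] by simp
        fix x y assume x: "x \<in> (\<Union>i<N. R (2 * i + p))" and y: "y \<in> R (2 * N + p)"
        obtain i where i: "i < N" "x \<in> R (2 * i + p)" using x by auto
        \<comment> \<open>Indices differing by at least 2 leave a whole shell in between: points of
          the earlier shells keep distance at least \<open>1 / (2 * N + p)\<close> from
          \<open>C\<close>, points of the new one stay below
          \<open>1 / (2 * N + p + 1)\<close>.\<close>
        have "inverse (real (2 * N + p)) \<le> inverse (real (Suc (Suc (2 * i + p))))"
          using i by (intro inv_mono) auto
        also have "\<dots> \<le> infdist x C" using i by (simp add: R_def)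
        finally show "inverse (real (2 * N + p)) - inverse (real (Suc (2 * N + p))) \<le> dist x y"
          by (rule sep) (use y in \<open>simp add: R_def\<close>)
      qed
    qed simp
    then have "(\<Sum>i<Suc N. ?H (R (2 * i + p))) \<le> ?H ((\<Union>i<N. R (2 * i + p)) \<union> R (2 * N + p))"
      unfolding sum.lessThan_Suc by (rule order_trans[OF add_right_mono[OF Suc.IH]])
    then show ?case by (simp only: lessThan_Suc UN_insert Un_commute)
  qed simp
  \<comment> \<open>Even and odd shells are summed separately; each of the two families lies in
    \<open>X\<close>, which accounts for the factor 2.\<close>
  have "(\<Sum>k. ?H (R k)) \<le> 2 * ?H X"
  proof (rule suminf_le_const)
    fix N
    have "(\<Sum>k<N. ?H (R k)) \<le> (\<Sum>k<2 * N. ?H (R k))"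
      by (rule sum_mono2) auto
    also have "\<dots> = (\<Sum>i<N. ?H (R (2 * i + 0))) + (\<Sum>i<N. ?H (R (2 * i + 1)))"
      by (induction N) (auto simp: add_ac)
    also have "\<dots> \<le> ?H X + ?H X"
      by (intro add_mono order_trans[OF sum_R] hausdorff_measure_mono) (auto simp: R_def)
    finally show "(\<Sum>k<N. ?H (R k)) \<le> 2 * ?H X" by (simp add: mult_2)
  qed auto
  then have sum_fin: "(\<Sum>k. ?H (R k)) \<noteq> top"
    using fin by (auto simp: top_unique ennreal_mult_eq_top_iff)
  show ?thesis
  proof (rule ennreal_le_epsilon)
    fix e :: real assume "0 < e"
    then obtain n where n: "(\<Sum>k. ?H (R (k + n))) \<le> ennreal e"
      using ennreal_suminf_tail_small[OF sum_fin] by blast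
    have Y: "?H (X \<inter> C) + ?H (Y n) \<le> ?H X"
    proof -
      have "?H (Y n) + ?H (X \<inter> C) \<le> ?H (Y n \<union> (X \<inter> C))"
      proof (rule hausdorff_measure_separated)
        show "0 < inverse (real (Suc n))" by simp
        fix x y assume "x \<in> Y n" "y \<in> X \<inter> C"
        then show "inverse (real (Suc n)) \<le> dist x y"
          using sep[of "inverse (real (Suc n))" x y 0] by (simp add: Y_def)
      qed
      also have "\<dots> \<le> ?H X" by (rule hausdorff_measure_mono) (auto simp: Y_def)
      finally show ?thesis by (simp add: add.commute)
    qed
    have "X - C \<subseteq> Y n \<union> (\<Union>k. R (k + n))"
    proof
      fix x assume x: "x \<in> X - C"
      then have "0 < infdist x C" using assms infdist_pos_not_in_closed by auto
      show "x \<in> Y n \<union> (\<Union>k. R (k + n))"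
      proof (cases "x \<in> Y n")
        case False
        \<comment> \<open>By minimality \<open>x\<close> lies in \<open>Y k\<close> but not in
          \<open>Y (k - 1)\<close>, which is membership in the shell \<open>R (k - 1)\<close>;
          \<open>n < k\<close> makes this one of the tail shells.\<close>
        define k where "k = (LEAST k. x \<in> Y k)"
        obtain j where "inverse (real (Suc j)) < infdist x C"
          using reals_Archimedean \<open>0 < infdist x C\<close> by blast
        then have "x \<in> Y j" using x by (simp add: Y_def)
        then have k: "x \<in> Y k" unfolding k_def by (rule LeastI)
        have "n < k"
        proof (rule ccontr)
          assume "\<not> n < k"
          then have "inverse (real (Suc n)) \<le> inverse (real (Suc k))" by (intro inv_mono) auto
          then show False using False k order_trans unfolding Y_def by blast
        qed
        then have "x \<notin> Y (k - 1)" unfolding k_def by (intro not_less_Least) auto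
        then have "x \<in> R ((k - 1 - n) + n)" using k x \<open>n < k\<close> by (auto simp: Y_def R_def)
        then show ?thesis by blast
      qed simp
    qed
    then have "?H (X - C) \<le> ?H (Y n) + ?H (\<Union>k. R (k + n))"
      using hausdorff_measure_mono hausdorff_measure_Un_le order_trans by blast
    also have "\<dots> \<le> ?H (Y n) + ennreal e"
      by (intro add_left_mono order_trans[OF hausdorff_measure_UN_le] n)
    finally have "?H (X \<inter> C) + ?H (X - C) \<le> ?H (X \<inter> C) + (?H (Y n) + ennreal e)"
      by (rule add_left_mono)
    also have "\<dots> \<le> ?H X + ennreal e"
      using Y by (simp add: add.assoc[symmetric] add_right_mono)
    finally show "?H (X \<inter> C) + ?H (X - C) \<le> ?H X + ennreal e" .
  qed
qed simp

text \<open>Caratheodory: the sets that split every set additively form a sigma-algebra on which the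
  outer measure is a measure. It contains the closed sets, hence all Borel sets.\<close>

lemma measure_space_hausdorff_measure:
  "measure_space UNIV (sets borel) (hausdorff_measure m :: 'a::metric_space set \<Rightarrow> ennreal)"
proof -
  interpret sigma_algebra "UNIV :: 'a set" UNIV
    using sigma_algebra_Pow[of UNIV] by simp
  let ?L = "lambda_system UNIV UNIV (hausdorff_measure m :: 'a set \<Rightarrow> ennreal)"
  have L: "measure_space UNIV ?L (hausdorff_measure m)"
    using hausdorff_measure_outer by (rule caratheodory_lemma)
  then interpret L: sigma_algebra UNIV ?L by (simp add: measure_space_def)
  have "C \<in> ?L" if "closed C" for C
  proof (cases "C = {}")
    case False
    have "hausdorff_measure m (X \<inter> C) + hausdorff_measure m (X - C) = hausdorff_measure m X" for X
      using hausdorff_measure_caratheodory_closed[OF that False]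
        hausdorff_measure_Un_le[of m "X \<inter> C" "X - C"]
      by (intro antisym) (auto simp: Int_Diff_Un)
    then show ?thesis by (simp add: lambda_system_eq)
  qed simp
  then have "U \<in> ?L" if "open U" for U
    using L.compl_sets[of "- U"] that by (simp add: Compl_eq_Diff_UNIV[symmetric] closed_Compl)
  then have "sigma_sets UNIV {U. open U} \<subseteq> ?L"
    by (intro L.sigma_sets_subset) auto
  then have "sets borel \<subseteq> ?L" by (simp add: borel_def)
  from measure_down[OF L _ this] show ?thesis
    using sets.sigma_algebra_axioms[of "borel :: 'a measure"] by simp
qed

section \<open>Hausdorff measure as a measure on the Borel sets\<close>

definition hausdorff_borel :: "nat \<Rightarrow> 'a::metric_space measure" where
  "hausdorff_borel m = measure_of UNIV (sets borel) (hausdorff_measure m)"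

lemma space_hausdorff_borel [simp]: "space (hausdorff_borel m) = UNIV"
  by (simp add: hausdorff_borel_def)

lemma sets_hausdorff_borel [simp, measurable_cong]: "sets (hausdorff_borel m) = sets borel"
  using sets.sigma_sets_eq[of borel] by (simp add: hausdorff_borel_def)

lemma emeasure_hausdorff_borel:
  "A \<in> sets borel \<Longrightarrow> emeasure (hausdorff_borel m) A = hausdorff_measure m A"
  unfolding hausdorff_borel_def
  using measure_space_hausdorff_measure[of m]
  by (intro emeasure_measure_of_sigma) (auto simp: measure_space_def)

section \<open>Translation invariant measures on a subspace\<close>

text \<open>In coordinates of an orthonormal basis of \<open>V\<close> the ball is covered by cubes
  of side \<open>1 / N\<close>. Their number grows like \<open>N ^ m\<close> while their weights
  shrink like \<open>1 / N ^ m\<close>, so the total stays bounded as the scale tends to 0.\<close>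

lemma hausdorff_measure_subspace_cball_finite:
  fixes V :: "'a::euclidean_space set" and R :: nat
  assumes V: "subspace V" "dim V = m" and R: "1 \<le> R"
  shows "hausdorff_measure m (V \<inter> cball 0 (real R)) < top"
proof -
  obtain B where B: "B \<subseteq> V" "pairwise orthogonal B" "\<And>x. x \<in> B \<Longrightarrow> norm x = 1"
      "independent B" "card B = dim V" "span B = V"
    using orthonormal_basis_subspace[OF V(1)] by metis
  have fin: "finite B" using B(4) by (rule independent_imp_finite)
  have expand: "(\<Sum>b\<in>B. (x \<bullet> b) *\<^sub>R b) = x" if "x \<in> V" for x
    using orthonormal_basis_expand[OF B(2,3) _ fin] B(6) that by blast
  let ?v = "unit_ball_vol (real m)"
  \<comment> \<open>This is at most \<open>(3 * N * R) ^ m\<close> cells times the weight of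
    diameter \<open>m / N\<close>; the factor \<open>N\<close> cancels.\<close>
  define K where "K = ?v * (3 * real R * real m / 2) ^ m"
  have "hausdorff_premeasure m \<delta> (V \<inter> cball 0 (real R)) \<le> ennreal K" if \<delta>: "0 < \<delta>" for \<delta>
  proof -
    obtain N :: nat where N: "0 < N" "real m / real N \<le> \<delta>"
    proof -
      obtain N :: nat where "real m / \<delta> < real N" using reals_Archimedean2 by blast
      then have "real m / real (Suc N) \<le> \<delta>" using \<delta> by (simp add: field_simps)
      then show ?thesis using that[of "Suc N"] by blast
    qed
    define I where "I = PiE B (\<lambda>_. {- int (N * R)..int (N * R)})"
    \<comment> \<open>The cells are half-open cubes, labelled by the integer parts of the rescaled
      coordinates. Adding up coordinate differences bounds their diameters by
      \<open>m / N\<close>.\<close>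
    define U where "U k = {x \<in> V. \<forall>b\<in>B. \<lfloor>real N * (x \<bullet> b)\<rfloor> = k b}" for k
    have close: "dist x y \<le> real m / real N" if xy: "x \<in> U k" "y \<in> U k" for x y k
    proof -
      have "\<bar>(x - y) \<bullet> b\<bar> \<le> 1 / real N" if b: "b \<in> B" for b
      proof -
        have "\<lfloor>real N * (x \<bullet> b)\<rfloor> = \<lfloor>real N * (y \<bullet> b)\<rfloor>"
          using xy b by (simp add: U_def)
        then have "\<bar>real N * (x \<bullet> b) - real N * (y \<bullet> b)\<bar> \<le> 1" by linarith
        then have "real N * \<bar>(x - y) \<bullet> b\<bar> \<le> 1"
          by (simp add: inner_diff_left right_diff_distrib[symmetric] abs_mult)
        then show ?thesis using N by (simp add: field_simps)
      qed
      then have "(\<Sum>b\<in>B. norm (((x - y) \<bullet> b) *\<^sub>R b)) \<le> (\<Sum>b\<in>B. 1 / real N)"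
        using B(3) by (intro sum_mono) simp
      moreover have "x - y \<in> V" using xy V(1) by (auto simp: U_def intro: subspace_diff)
      ultimately have "norm (x - y) \<le> (\<Sum>b\<in>B. 1 / real N)"
        using expand norm_sum[of "\<lambda>b. ((x - y) \<bullet> b) *\<^sub>R b" B] by simp
      then show ?thesis using B(5) V(2) by (simp add: dist_norm)
    qed
    have bnd: "bounded (U k)" for k
    proof (cases "U k = {}")
      case False
      then obtain x where "x \<in> U k" by auto
      then show ?thesis unfolding bounded_def using close by blast
    qed auto
    have diam: "diameter (U k) \<le> real m / real N" for k
      using close by (intro diameter_le) (auto simp: dist_norm)
    have "hausdorff_premeasure m \<delta> (V \<inter> cball 0 (real R)) \<le> (\<Sum>k\<in>I. hausdorff_weight m (U k))"
    proof (rule hausdorff_premeasure_finite_cover)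
      show "finite I" unfolding I_def using fin by (intro finite_PiE) auto
      show "V \<inter> cball 0 (real R) \<subseteq> (\<Union>k\<in>I. U k)"
      proof
        fix x assume x: "x \<in> V \<inter> cball 0 (real R)"
        define k where "k = restrict (\<lambda>b. \<lfloor>real N * (x \<bullet> b)\<rfloor>) B"
        have "k b \<in> {- int (N * R)..int (N * R)}" if b: "b \<in> B" for b
        proof -
          have "\<bar>x \<bullet> b\<bar> \<le> real R"
            using Cauchy_Schwarz_ineq2[of x b] B(3)[OF b] x by (simp add: dist_norm)
          then have "real N * \<bar>x \<bullet> b\<bar> \<le> real N * real R" by (intro mult_left_mono) auto
          then have "\<bar>real N * (x \<bullet> b)\<bar> \<le> real_of_int (int (N * R))" by (simp add: abs_mult)
          then have "- int (N * R) \<le> \<lfloor>real N * (x \<bullet> b)\<rfloor>" "\<lfloor>real N * (x \<bullet> b)\<rfloor> \<le> int (N * R)"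
            by linarith+
          then show ?thesis using b by (simp add: k_def)
        qed
        then have "k \<in> I" unfolding I_def by (auto simp: k_def)
        moreover have "x \<in> U k" using x by (simp add: U_def k_def)
        ultimately show "x \<in> (\<Union>k\<in>I. U k)" by blast
      qed
      show "diameter (U k) \<le> \<delta>" for k using diam[of k] N(2) by linarith
    qed (use bnd \<delta> in auto)
    also have "\<dots> \<le> (\<Sum>k\<in>I. ennreal (?v * (real m / real N / 2) ^ m))"
    proof (rule sum_mono)
      fix k
      have "?v * (diameter (U k) / 2) ^ m \<le> ?v * (real m / real N / 2) ^ m"
        using diameter_ge_0[OF bnd, of k] diam[of k]
        by (intro mult_left_mono power_mono divide_right_mono) auto
      then show "hausdorff_weight m (U k) \<le> ennreal (?v * (real m / real N / 2) ^ m)"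
        by (auto simp: hausdorff_weight_def intro!: ennreal_leI)
    qed
    also have "\<dots> = ennreal (real (card I) * (?v * (real m / real N / 2) ^ m))"
      by (simp add: ennreal_mult' ennreal_of_nat_eq_real_of_nat)
    also have "\<dots> \<le> ennreal K"
    proof (rule ennreal_leI)
      have "card I = (2 * (N * R) + 1) ^ m"
        unfolding I_def using fin B(5) V(2) by (simp add: card_PiE nat_add_distrib nat_mult_distrib)
      \<comment> \<open>The extra 1 is absorbed because \<open>N * R\<close> is at least 1.\<close>
      also have "\<dots> \<le> (3 * (N * R)) ^ m"
        using N R by (intro power_mono) (auto simp: Suc_le_eq)
      finally have "real (card I) \<le> real ((3 * (N * R)) ^ m)" by (rule of_nat_mono)
      then have "real (card I) * (?v * (real m / real N / 2) ^ m) \<le>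
          real ((3 * (N * R)) ^ m) * (?v * (real m / real N / 2) ^ m)"
        by (rule mult_right_mono) simp
      also have "\<dots> = ?v * (3 * (real N * real R) * (real m / real N / 2)) ^ m"
        by (simp only: of_nat_power of_nat_mult of_nat_numeral power_mult_distrib mult_ac)
      also have "3 * (real N * real R) * (real m / real N / 2) = 3 * real R * real m / 2"
        using N by simp
      finally show "real (card I) * (?v * (real m / real N / 2) ^ m) \<le> K"
        unfolding K_def .
    qed
    finally show ?thesis .
  qed
  then have "hausdorff_measure m (V \<inter> cball 0 (real R)) \<le> ennreal K"
    unfolding hausdorff_measure_def by (intro SUP_least) auto
  then show ?thesis by (simp add: le_less_trans)
qed

text \<open>Uniqueness of Haar measure on \<open>V\<close>: Fubini's theorem applied to \<open>(x, y) \<mapsto> 1\<^sub>A x * 1\<^sub>B (x + y)\<close>,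
  with \<open>x\<close> and \<open>y\<close> shifted in turn.\<close>

lemma invariant_measures_proportional:
  fixes M N :: "'a::euclidean_space measure"
  assumes M: "sigma_finite_measure M" and N: "sigma_finite_measure N"
    and sets_M [measurable_cong]: "sets M = sets borel" and sets_N [measurable_cong]: "sets N = sets borel"
    and V: "subspace V" "AE x in M. x \<in> V" "AE x in N. x \<in> V"
    and inv_M: "\<And>v. v \<in> V \<Longrightarrow> distr M borel ((+) v) = M"
    and inv_N: "\<And>v. v \<in> V \<Longrightarrow> distr N borel ((+) v) = N"
    and refl_N: "distr N borel uminus = N"
    and A [measurable]: "A \<in> sets borel" and B [measurable]: "B \<in> sets borel"
  shows "emeasure M A * emeasure N B = emeasure N A * emeasure M B"
proof -
  interpret M: sigma_finite_measure M by fact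
  interpret N: sigma_finite_measure N by fact
  interpret P: pair_sigma_finite N M ..
  have shift_M: "(\<integral>\<^sup>+ x. f (v + x) \<partial>M) = (\<integral>\<^sup>+ x. f x \<partial>M)"
    if "v \<in> V" "f \<in> borel_measurable borel" for v and f :: "'a \<Rightarrow> ennreal"
    using that(2) by (subst (2) inv_M[OF that(1), symmetric]) (simp add: nn_integral_distr)
  have shift_N: "(\<integral>\<^sup>+ x. f (v + x) \<partial>N) = (\<integral>\<^sup>+ x. f x \<partial>N)"
    if "v \<in> V" "f \<in> borel_measurable borel" for v and f :: "'a \<Rightarrow> ennreal"
    using that(2) by (subst (2) inv_N[OF that(1), symmetric]) (simp add: nn_integral_distr)
  have reflect_N: "(\<integral>\<^sup>+ x. f (- x) \<partial>N) = (\<integral>\<^sup>+ x. f x \<partial>N)"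
    if "f \<in> borel_measurable borel" for f :: "'a \<Rightarrow> ennreal"
    using that by (subst (2) refl_N[symmetric]) (simp add: nn_integral_distr)
  let ?a = "indicator A :: 'a \<Rightarrow> ennreal" and ?b = "indicator B :: 'a \<Rightarrow> ennreal"
  have "emeasure M A * emeasure N B = (\<integral>\<^sup>+ x. ?a x * (\<integral>\<^sup>+ y. ?b y \<partial>N) \<partial>M)"
    by (simp add: nn_integral_multc sets_M sets_N)
  \<comment> \<open>Invariance holds only for translations by vectors of \<open>V\<close>, so the
    shift by \<open>x\<close> is made almost everywhere.\<close>
  also have "\<dots> = (\<integral>\<^sup>+ x. (\<integral>\<^sup>+ y. ?a x * ?b (x + y) \<partial>N) \<partial>M)"
    using V(2) by (intro nn_integral_cong_AE, eventually_elim)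
      (simp add: nn_integral_cmult shift_N)
  also have "\<dots> = (\<integral>\<^sup>+ y. (\<integral>\<^sup>+ x. ?a x * ?b (x + y) \<partial>M) \<partial>N)"
    by (rule P.Fubini') measurable
  also have "\<dots> = (\<integral>\<^sup>+ y. (\<integral>\<^sup>+ x. ?a (x - y) * ?b x \<partial>M) \<partial>N)"
    using V(3)
  proof (intro nn_integral_cong_AE, eventually_elim)
    fix y assume "y \<in> V"
    then show "(\<integral>\<^sup>+ x. ?a x * ?b (x + y) \<partial>M) = (\<integral>\<^sup>+ x. ?a (x - y) * ?b x \<partial>M)"
      using shift_M[of y "\<lambda>x. ?a (x - y) * ?b x"] by (simp add: add.commute)
  qed
  also have "\<dots> = (\<integral>\<^sup>+ x. (\<integral>\<^sup>+ y. ?a (x - y) * ?b x \<partial>N) \<partial>M)"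
    by (rule P.Fubini'[symmetric]) measurable
  also have "\<dots> = (\<integral>\<^sup>+ x. emeasure N A * ?b x \<partial>M)"
    using V(2)
  proof (intro nn_integral_cong_AE, eventually_elim)
    fix x assume x: "x \<in> V"
    have "(\<integral>\<^sup>+ y. ?a (x - y) * ?b x \<partial>N) = (\<integral>\<^sup>+ y. ?a (x + - y) \<partial>N) * ?b x"
      by (simp add: nn_integral_multc)
    \<comment> \<open>Reflection changes the sign of \<open>y\<close>, after which the integrand is
      a translate.\<close>
    also have "(\<integral>\<^sup>+ y. ?a (x + - y) \<partial>N) = (\<integral>\<^sup>+ y. ?a (x + y) \<partial>N)"
      by (rule reflect_N) measurable
    also have "\<dots> = (\<integral>\<^sup>+ y. ?a y \<partial>N)" by (rule shift_N[OF x]) measurable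
    finally show "(\<integral>\<^sup>+ y. ?a (x - y) * ?b x \<partial>N) = emeasure N A * ?b x"
      by (simp add: sets_N)
  qed
  also have "\<dots> = emeasure N A * emeasure M B"
    by (simp add: nn_integral_cmult sets_M)
  finally show ?thesis .
qed

section \<open>Scaling in one direction\<close>

text \<open>Restriction to \<open>V\<close> is encoded by a density, so that the measure still lives
  on the Borel sets of the whole space and linear maps remain plain Borel maps.\<close>

definition hausdorff_borel_on :: "'a::metric_space set \<Rightarrow> nat \<Rightarrow> 'a measure" where
  "hausdorff_borel_on V m = density (hausdorff_borel m) (indicator V)"

lemma space_hausdorff_borel_on [simp]: "space (hausdorff_borel_on V m) = UNIV"
  by (simp add: hausdorff_borel_on_def)

lemma sets_hausdorff_borel_on [simp, measurable_cong]: "sets (hausdorff_borel_on V m) = sets borel"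
  by (simp add: hausdorff_borel_on_def)

lemma emeasure_hausdorff_borel_on:
  assumes "V \<in> sets borel" "A \<in> sets borel"
  shows "emeasure (hausdorff_borel_on V m) A = hausdorff_measure m (V \<inter> A)"
  using assms by (simp add: hausdorff_borel_on_def emeasure_restricted emeasure_hausdorff_borel)

lemma AE_hausdorff_borel_on:
  assumes "V \<in> sets borel"
  shows "AE x in hausdorff_borel_on V m. x \<in> V"
  using assms unfolding hausdorff_borel_on_def
  by (subst AE_density) (auto simp: indicator_def)

text \<open>The isometry \<open>g\<close> carries the part of \<open>V\<close> over \<open>A\<close>
  onto the part of \<open>V\<close> in \<open>A\<close>. It is applied to translations by vectors of
  \<open>V\<close> and to the reflection in the origin.\<close>

lemma distr_hausdorff_borel_on_isometry:
  assumes V: "V \<in> sets borel" and g: "g \<in> borel_measurable borel"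
    and iso: "\<And>x y. dist (g x) (g y) = dist x y"
    and gV: "\<And>x. g x \<in> V \<longleftrightarrow> x \<in> V" and surj: "surj g"
  shows "distr (hausdorff_borel_on V m) borel g = hausdorff_borel_on V m"
proof (rule measure_eqI)
  fix A assume "A \<in> sets (distr (hausdorff_borel_on V m) borel g)"
  then have A: "A \<in> sets borel" by simp
  have gA: "g -` A \<in> sets borel" using measurable_sets[OF g A] by simp
  have "g ` (V \<inter> g -` A) = V \<inter> A"
  proof
    show "V \<inter> A \<subseteq> g ` (V \<inter> g -` A)"
    proof
      fix x assume "x \<in> V \<inter> A"
      moreover obtain y where "x = g y" using surj by (rule surjE)
      ultimately show "x \<in> g ` (V \<inter> g -` A)" using gV by blast
    qed
  qed (use gV in auto)
  then have "hausdorff_measure m (V \<inter> g -` A) = hausdorff_measure m (V \<inter> A)"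
    using hausdorff_measure_isometric_image[of "V \<inter> g -` A" g m, OF iso] by simp
  moreover have "g \<in> hausdorff_borel_on V m \<rightarrow>\<^sub>M borel"
    using g by measurable
  ultimately show "emeasure (distr (hausdorff_borel_on V m) borel g) A = emeasure (hausdorff_borel_on V m) A"
    using V A gA by (simp add: emeasure_distr emeasure_hausdorff_borel_on)
qed simp

section \<open>Linear automorphisms of a subspace multiply its Hausdorff measure by a
  constant\<close>

lemma sigma_finite_measure_cball:
  fixes M :: "'a::real_normed_vector measure"
  assumes [simp]: "sets M = sets borel" and fin: "\<And>R :: nat. emeasure M (cball 0 (real R)) < top"
  shows "sigma_finite_measure M"
proof
  have "(\<Union>R::nat. cball 0 (real R)) = (UNIV :: 'a set)"
    by (auto simp: real_arch_simple)
  moreover have "space M = UNIV" using sets_eq_imp_space_eq[of M borel] by simp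
  ultimately show "\<exists>A. countable A \<and> A \<subseteq> sets M \<and> \<Union> A = space M \<and> (\<forall>a\<in>A. emeasure M a \<noteq> \<infinity>)"
    using fin by (intro exI[of _ "range (\<lambda>R::nat. cball 0 (real R))"]) (auto simp: less_top)
qed

lemma hausdorff_measure_subspace_cball_less_top:
  fixes V :: "'a::euclidean_space set" and R :: real
  assumes V: "subspace V" "dim V = m"
  shows "hausdorff_measure m (V \<inter> cball 0 R) < top"
proof -
  obtain N :: nat where "max R 1 \<le> real N" using real_arch_simple by blast
  then have "1 \<le> N" "V \<inter> cball 0 R \<subseteq> V \<inter> cball 0 (real N)" by auto
  then show ?thesis
    using hausdorff_measure_subspace_cball_finite[OF V] hausdorff_measure_mono le_less_trans by blast
qed

text \<open>If all balls of \<open>V\<close> are null, so is their countable union \<open>V\<close>.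
  The dichotomy permits division by the measure of a ball without a proof that Hausdorff measure is
  positive on \<open>V\<close>.\<close>

lemma hausdorff_measure_subspace_trivial_or_ball:
  fixes V :: "'a::euclidean_space set"
  obtains "\<And>A. A \<subseteq> V \<Longrightarrow> hausdorff_measure m A = 0"
    | R where "hausdorff_measure m (V \<inter> cball 0 R) \<noteq> 0"
proof (cases "\<forall>R :: nat. hausdorff_measure m (V \<inter> cball 0 (real R)) = 0")
  case True
  have "hausdorff_measure m A = 0" if "A \<subseteq> V" for A
  proof -
    have "A \<subseteq> (\<Union>R::nat. V \<inter> cball 0 (real R))"
      using that by (auto simp: real_arch_simple)
    then have "hausdorff_measure m A \<le> (\<Sum>R::nat. hausdorff_measure m (V \<inter> cball 0 (real R)))"
      by (rule order_trans[OF hausdorff_measure_mono hausdorff_measure_UN_le])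
    then show ?thesis using True by simp
  qed
  then show ?thesis using that(1) by blast
next
  case False
  then show ?thesis using that(2) by blast
qed

text \<open>Measuring sets after applying \<open>T\<close> again gives a measure on \<open>V\<close>
  that is finite on balls and invariant under translations and reflection, hence one proportional to
  the original.\<close>

lemma hausdorff_measure_linear_image:
  fixes V :: "'a::euclidean_space set"
  assumes V: "subspace V" "dim V = m"
    and T: "linear T" "linear T'" "\<And>x. T (T' x) = x" "\<And>x. T' (T x) = x"
    and TV: "\<And>x. x \<in> V \<Longrightarrow> T x \<in> V" "\<And>x. x \<in> V \<Longrightarrow> T' x \<in> V"
  obtains c :: ennreal where
    "\<And>A. A \<in> sets borel \<Longrightarrow> A \<subseteq> V \<Longrightarrow> hausdorff_measure m (T ` A) = c * hausdorff_measure m A"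
proof -
  have V_borel [measurable]: "V \<in> sets borel" using V(1) closed_subspace borel_closed by blast
  have T_meas [measurable]: "T \<in> borel_measurable borel" "T' \<in> borel_measurable borel"
    using T by (auto intro!: borel_measurable_continuous_onI linear_continuous_on simp: linear_conv_bounded_linear)
  define M where "M = hausdorff_borel_on V m"
  \<comment> \<open>The push-forward is along the inverse \<open>T'\<close>, whose preimages are
    images under \<open>T\<close>.\<close>
  define N where "N = distr M borel T'"
  have [measurable_cong, simp]: "sets M = sets borel" "sets N = sets borel"
    by (simp_all add: M_def N_def)
  have T'_meas_M [measurable]: "T' \<in> M \<rightarrow>\<^sub>M borel" by measurable
  have M_eq: "emeasure M A = hausdorff_measure m (V \<inter> A)" if "A \<in> sets borel" for A
    using that V_borel by (simp add: M_def emeasure_hausdorff_borel_on)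
  have T_image: "V \<inter> T' -` A = T ` (V \<inter> A)" for A
    using T TV by (auto intro!: image_eqI[where x = "T' _"])
  have N_eq: "emeasure N A = hausdorff_measure m (T ` (V \<inter> A))" if A: "A \<in> sets borel" for A
  proof -
    have "T' -` A \<in> sets borel" using measurable_sets[OF T_meas(2) A] by simp
    then show ?thesis using A unfolding N_def T_image[symmetric]
      by (simp add: emeasure_distr T'_meas_M M_eq[symmetric])
  qed
  have "sigma_finite_measure M"
    by (rule sigma_finite_measure_cball)
      (auto simp: M_eq hausdorff_measure_subspace_cball_less_top[OF V])
  moreover have "sigma_finite_measure N"
  proof (rule sigma_finite_measure_cball)
    fix R :: nat
    obtain K where K: "\<And>x. norm (T x) \<le> norm x * K"
      using T(1) bounded_linear.bounded by (metis linear_conv_bounded_linear)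
    have "norm (T x) \<le> \<bar>K\<bar> * real R" if "norm x \<le> real R" for x
    proof -
      have "norm (T x) \<le> norm x * \<bar>K\<bar>" using order_trans[OF K mult_left_mono[of K "\<bar>K\<bar>"]] by simp
      also have "\<dots> \<le> real R * \<bar>K\<bar>" using that by (rule mult_right_mono) simp
      finally show ?thesis by (simp add: mult.commute)
    qed
    then have "T ` (V \<inter> cball 0 (real R)) \<subseteq> V \<inter> cball 0 (\<bar>K\<bar> * real R)"
      using TV by auto
    then have "hausdorff_measure m (T ` (V \<inter> cball 0 (real R))) < top"
      by (rule le_less_trans[OF hausdorff_measure_mono hausdorff_measure_subspace_cball_less_top[OF V]])
    then show "emeasure N (cball 0 (real R)) < top"
      by (simp add: N_eq)
  qed simp
  moreover have AE_M: "AE x in M. x \<in> V" unfolding M_def by (rule AE_hausdorff_borel_on[OF V_borel])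
  moreover have "AE x in N. x \<in> V"
    unfolding N_def using AE_M TV by (subst AE_distr_iff) (auto elim!: eventually_mono)
  moreover have inv_M: "distr M borel ((+) v) = M" if "v \<in> V" for v
    unfolding M_def
  proof (rule distr_hausdorff_borel_on_isometry[OF V_borel])
    show "v + x \<in> V \<longleftrightarrow> x \<in> V" for x
      using that V(1) by (metis add_diff_cancel_left' subspace_add subspace_diff)
  qed simp_all
  moreover have "distr N borel ((+) v) = N" if "v \<in> V" for v
  proof -
    \<comment> \<open>Translation by \<open>v\<close> after \<open>T'\<close> is translation by
      \<open>T v\<close> before it, and \<open>T v\<close> stays in \<open>V\<close>.\<close>
    have "(+) v \<circ> T' = T' \<circ> (+) (T v)"
      using T by (auto simp: linear_add)
    then have "distr N borel ((+) v) = distr (distr M borel ((+) (T v))) borel T'"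
      unfolding N_def by (subst (1 2) distr_distr) (auto simp: )
    then show ?thesis using inv_M TV(1) that by (simp add: N_def)
  qed
  moreover have "distr N borel uminus = N"
  proof -
    have "distr M borel uminus = M"
      unfolding M_def
    proof (rule distr_hausdorff_borel_on_isometry[OF V_borel])
      show "- x \<in> V \<longleftrightarrow> x \<in> V" for x
        using V(1) by (metis minus_minus subspace_neg)
    qed (simp_all add: dist_minus)
    moreover have "uminus \<circ> T' = T' \<circ> uminus" using T by (auto simp: linear_neg)
    then have "distr N borel uminus = distr (distr M borel uminus) borel T'"
      unfolding N_def by (subst (1 2) distr_distr) auto
    ultimately show ?thesis by (simp add: N_def)
  qed
  ultimately have proportional: "emeasure M A * emeasure N B = emeasure N A * emeasure M B"
    if "A \<in> sets borel" "B \<in> sets borel" for A B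
    using that V(1) by (intro invariant_measures_proportional[where V = V]) auto
  show ?thesis
  proof (cases rule: hausdorff_measure_subspace_trivial_or_ball[of V m])
    case 1
    have "hausdorff_measure m (T ` A) = 0 * hausdorff_measure m A" if "A \<subseteq> V" for A
    proof -
      have "T ` A \<subseteq> V" using TV(1) that by blast
      then show ?thesis using 1 by simp
    qed
    then show ?thesis using that by blast
  next
    case (2 R)
    define B where "B = V \<inter> cball 0 R"
    have B: "B \<in> sets borel" "hausdorff_measure m B \<noteq> 0" "hausdorff_measure m B \<noteq> top"
      using 2 hausdorff_measure_subspace_cball_less_top[OF V, of R] by (auto simp: B_def less_top)
    \<comment> \<open>The constant is read off from one ball \<open>B\<close> of positive finite
      measure.\<close>
    have "hausdorff_measure m (T ` A) = hausdorff_measure m (T ` B) / hausdorff_measure m B * hausdorff_measure m A"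
      if A: "A \<in> sets borel" "A \<subseteq> V" for A
    proof -
      have "V \<inter> A = A" "V \<inter> B = B" using A by (auto simp: B_def)
      then have "hausdorff_measure m A * hausdorff_measure m (T ` B) = hausdorff_measure m (T ` A) * hausdorff_measure m B"
        using proportional[OF A(1) B(1)] A(1) B(1) by (simp add: M_eq N_eq)
      then have "hausdorff_measure m (T ` A) * hausdorff_measure m B / hausdorff_measure m B =
          hausdorff_measure m A * hausdorff_measure m (T ` B) / hausdorff_measure m B" by simp
      then show ?thesis
        unfolding mult_divide_eq_ennreal[OF B(2,3)]
        by (simp add: ennreal_times_divide mult.commute[of _ "hausdorff_measure m A"])
    qed
    then show ?thesis using that by blast
  qed
qed

section \<open>Dilations along a unit vector that fix its orthogonal complement\<close>

definition axis_scale :: "'a::real_inner \<Rightarrow> real \<Rightarrow> 'a \<Rightarrow> 'a" where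
  "axis_scale u s x = x + ((s - 1) * (x \<bullet> u)) *\<^sub>R u"

lemma linear_axis_scale: "linear (axis_scale u s)"
  by (rule linearI) (auto simp: axis_scale_def inner_add_left algebra_simps)

lemma axis_scale_inner: "norm u = 1 \<Longrightarrow> axis_scale u s x \<bullet> u = s * (x \<bullet> u)"
  by (simp add: axis_scale_def inner_add_left dot_square_norm algebra_simps)

lemma axis_scale_inverse:
  assumes "norm u = 1" "s \<noteq> 0"
  shows "axis_scale u s (axis_scale u (inverse s) x) = x"
proof -
  have "axis_scale u s (axis_scale u (inverse s) x) = x + (((inverse s - 1) + (s - 1) * inverse s) * (x \<bullet> u)) *\<^sub>R u"
    unfolding axis_scale_def[of u s] axis_scale_inner[OF assms(1)]
    by (simp add: axis_scale_def algebra_simps)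
  also have "(inverse s - 1) + (s - 1) * inverse s = 0" using assms(2) by (simp add: field_simps)
  finally show ?thesis by simp
qed

lemma axis_scale_in_subspace: "subspace V \<Longrightarrow> u \<in> V \<Longrightarrow> x \<in> V \<Longrightarrow> axis_scale u s x \<in> V"
  unfolding axis_scale_def by (intro subspace_add subspace_scale)

lemma axis_scale_image_borel:
  fixes u :: "'a::euclidean_space"
  assumes "norm u = 1" "s \<noteq> 0" "A \<in> sets borel"
  shows "axis_scale u s ` A \<in> sets borel"
proof -
  have "axis_scale u (inverse s) \<in> borel_measurable borel"
    by (intro borel_measurable_continuous_onI linear_continuous_on)
      (simp add: linear_conv_bounded_linear[symmetric] linear_axis_scale)
  from measurable_sets[OF this assms(3)]
  have "axis_scale u (inverse s) -` A \<in> sets borel" by simp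
  also have "axis_scale u (inverse s) -` A = axis_scale u s ` A"
    using axis_scale_inverse[OF assms(1,2)] axis_scale_inverse[OF assms(1), of "inverse s"] assms(2)
    by (auto intro: image_eqI[where x = "axis_scale u (inverse s) _"])
  finally show ?thesis .
qed

text \<open>All the directions \<open>u\<close> have the same scaling factor: a reflection of \<open>V\<close> exchanges any two unit vectors.\<close>

lemma hausdorff_measure_axis_scale_exists:
  fixes V :: "'a::euclidean_space set"
  assumes V: "subspace V" "dim V = m" and s: "0 < s"
  obtains c :: ennreal where
    "\<And>u A. u \<in> V \<Longrightarrow> norm u = 1 \<Longrightarrow> A \<in> sets borel \<Longrightarrow> A \<subseteq> V \<Longrightarrow>
      hausdorff_measure m (axis_scale u s ` A) = c * hausdorff_measure m A"
proof (cases "\<exists>v\<in>V. norm v = 1")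
  case True
  then obtain v where v: "v \<in> V" "norm v = 1" by blast
  obtain c where c: "\<And>A. A \<in> sets borel \<Longrightarrow> A \<subseteq> V \<Longrightarrow> hausdorff_measure m (axis_scale v s ` A) = c * hausdorff_measure m A"
  proof (rule hausdorff_measure_linear_image[OF V linear_axis_scale linear_axis_scale])
    show "axis_scale v s (axis_scale v (inverse s) x) = x" "axis_scale v (inverse s) (axis_scale v s x) = x" for x
      using axis_scale_inverse[OF v(2)] axis_scale_inverse[OF v(2), of "inverse s"] s by auto
  qed (use V v axis_scale_in_subspace in auto)
  have "hausdorff_measure m (axis_scale u s ` A) = c * hausdorff_measure m A"
    if u: "u \<in> V" "norm u = 1" and A: "A \<in> sets borel" "A \<subseteq> V" for u A
  proof -
    define w where "w = u - v"
    \<comment> \<open>This is the reflection in the hyperplane orthogonal to \<open>u - v\<close>.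
      It preserves \<open>V\<close>, since \<open>w\<close> lies in \<open>V\<close>, and it is the
      identity if \<open>u = v\<close>.\<close>
    define r where "r x = x - (2 * (x \<bullet> w) / (w \<bullet> w)) *\<^sub>R w" for x
    have lin: "linear r"
      by (rule linearI) (auto simp: r_def inner_add_left algebra_simps add_divide_distrib)
    have rw: "r x \<bullet> w = - (x \<bullet> w)" for x
      by (cases "w = 0") (auto simp: r_def inner_diff_left)
    have rr: "r (r x) = x" for x
      unfolding r_def[of "r x"] rw by (simp add: r_def)
    have inner_r: "r x \<bullet> y = x \<bullet> r y" for x y
      by (simp add: r_def inner_diff_left inner_diff_right inner_commute)
    have "norm (r x) = norm x" for x
      by (simp add: norm_eq_sqrt_inner inner_r rr)
    then have iso: "dist (r x) (r y) = dist x y" for x y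
      by (simp add: dist_norm linear_diff[OF lin, symmetric])
    have rv: "r v = u"
    proof (cases "w = 0")
      case False
      have "v \<bullet> w = v \<bullet> u - 1" "w \<bullet> w = 2 - 2 * (v \<bullet> u)"
        using u v unfolding w_def inner_diff_left inner_diff_right
        by (simp_all add: dot_square_norm inner_commute)
      then have "2 * (v \<bullet> w) / (w \<bullet> w) = -1" using False by (simp add: field_simps)
      then show ?thesis by (simp add: r_def) (simp add: w_def)
    qed (simp add: r_def w_def)
    have rV: "r x \<in> V" if "x \<in> V" for x
      using that u v V unfolding r_def w_def by (intro subspace_diff subspace_scale)
    have r_image: "r ` A = r -` A"
      using rr by (auto intro: image_eqI[where x = "r _"])
    have "r \<in> borel_measurable borel"
      using lin by (intro borel_measurable_continuous_onI linear_continuous_on)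
        (simp add: linear_conv_bounded_linear[symmetric])
    from measurable_sets[OF this A(1)] have rA: "r ` A \<in> sets borel" by (simp add: r_image)
    \<comment> \<open>Since \<open>r\<close> exchanges \<open>u\<close> and \<open>v\<close>, it
      conjugates one dilation into the other.\<close>
    have "axis_scale u s x = r (axis_scale v s (r x))" for x
    proof -
      have "x \<bullet> u = r x \<bullet> v" by (simp add: rv[symmetric] inner_r)
      then show ?thesis
        by (simp add: axis_scale_def linear_add[OF lin] linear_scale[OF lin] rr rv)
    qed
    then have "axis_scale u s ` A = r ` axis_scale v s ` r ` A" by (simp add: image_image)
    then have "hausdorff_measure m (axis_scale u s ` A) = hausdorff_measure m (axis_scale v s ` r ` A)"
      using iso by (simp only: hausdorff_measure_isometric_image)
    also have "\<dots> = c * hausdorff_measure m (r ` A)"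
      using rV A(2) by (intro c rA) auto
    also have "\<dots> = c * hausdorff_measure m A" using iso by (simp only: hausdorff_measure_isometric_image)
    finally show ?thesis .
  qed
  then show ?thesis using that by blast
qed (use that in blast)

lemma hausdorff_measure_axis_scale:
  fixes V :: "'a::euclidean_space set"
  assumes V: "subspace V" "dim V = m" and s: "0 < s" and u: "u \<in> V" "norm u = 1"
    and A: "A \<in> sets borel" "A \<subseteq> V"
  shows "hausdorff_measure m (axis_scale u s ` A) = ennreal s * hausdorff_measure m A"
proof -
  obtain c where c: "\<And>u A. u \<in> V \<Longrightarrow> norm u = 1 \<Longrightarrow> A \<in> sets borel \<Longrightarrow> A \<subseteq> V \<Longrightarrow>
      hausdorff_measure m (axis_scale u s ` A) = c * hausdorff_measure m A"
    using hausdorff_measure_axis_scale_exists[OF V s] by metis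
  obtain B where B: "B \<subseteq> V" "pairwise orthogonal B" "\<And>x. x \<in> B \<Longrightarrow> norm x = 1"
      "independent B" "card B = dim V" "span B = V"
    using orthonormal_basis_subspace[OF V(1)] by metis
  have fin: "finite B" using B(4) by (rule independent_imp_finite)
  have expand: "(\<Sum>b\<in>B. (x \<bullet> b) *\<^sub>R b) = x" if "x \<in> V" for x
    using orthonormal_basis_expand[OF B(2,3) _ fin] B(6) that by blast
  \<comment> \<open>The map dilates by \<open>s\<close> along every vector of \<open>F\<close>.
    Splitting off one basis vector at a time contributes one factor \<open>c\<close> each.\<close>
  have partial: "hausdorff_measure m ((\<lambda>x. x + (s - 1) *\<^sub>R (\<Sum>b\<in>F. (x \<bullet> b) *\<^sub>R b)) ` A) = c ^ card F * hausdorff_measure m A"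
    if "F \<subseteq> B" "A \<in> sets borel" "A \<subseteq> V" for F A
    using finite_subset[OF that(1) fin] that
  proof (induction F arbitrary: A rule: finite_induct)
    case (insert f F)
    have f: "f \<in> V" "norm f = 1" using insert.prems B by auto
    let ?T = "axis_scale f s"
    \<comment> \<open>By orthogonality, dilating along \<open>f\<close> leaves the coordinates along
      \<open>F\<close> unchanged.\<close>
    have inner_T: "?T x \<bullet> b = x \<bullet> b" if "b \<in> F" for x b
    proof -
      have "f \<noteq> b" "f \<in> B" "b \<in> B" using that insert by auto
      then have "f \<bullet> b = 0" using B(2) by (auto simp: pairwise_def orthogonal_def)
      then show ?thesis by (simp add: axis_scale_def inner_add_left)
    qed
    have "(\<lambda>x. x + (s - 1) *\<^sub>R (\<Sum>b\<in>insert f F. (x \<bullet> b) *\<^sub>R b)) ` A =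
        (\<lambda>x. x + (s - 1) *\<^sub>R (\<Sum>b\<in>F. (x \<bullet> b) *\<^sub>R b)) ` ?T ` A"
      unfolding image_image
    proof (intro image_cong refl)
      fix x
      have "(\<Sum>b\<in>F. (?T x \<bullet> b) *\<^sub>R b) = (\<Sum>b\<in>F. (x \<bullet> b) *\<^sub>R b)"
        by (intro sum.cong) (simp_all add: inner_T)
      then show "x + (s - 1) *\<^sub>R (\<Sum>b\<in>insert f F. (x \<bullet> b) *\<^sub>R b) =
          ?T x + (s - 1) *\<^sub>R (\<Sum>b\<in>F. (?T x \<bullet> b) *\<^sub>R b)"
        using insert.hyps by (simp add: axis_scale_def scaleR_add_right add_ac)
    qed
    also have "hausdorff_measure m \<dots> = c ^ card F * hausdorff_measure m (?T ` A)"
      using insert.prems s f axis_scale_in_subspace[OF V(1) f(1)]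
      by (intro insert.IH axis_scale_image_borel) auto
    also have "\<dots> = c ^ card F * (c * hausdorff_measure m A)"
      using c[OF f] insert.prems by simp
    finally show ?case using insert.hyps by (simp add: mult_ac)
  qed simp
  have power: "c ^ m * hausdorff_measure m A = ennreal (s ^ m) * hausdorff_measure m A"
    if "A \<in> sets borel" "A \<subseteq> V" for A
  proof -
    have "(\<lambda>x. x + (s - 1) *\<^sub>R (\<Sum>b\<in>B. (x \<bullet> b) *\<^sub>R b)) ` A = (*\<^sub>R) s ` A"
      using expand that(2) by (intro image_cong refl) (auto simp: subset_iff algebra_simps)
    then show ?thesis
      using partial[OF order_refl that] hausdorff_measure_scaleR[OF s, of m A] B(5) V(2) by simp
  qed
  \<comment> \<open>The exponent must be positive to conclude \<open>c = s\<close> from equal powers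
    and to exclude an infinite \<open>c\<close>.\<close>
  have "0 < m"
  proof (rule ccontr)
    assume "\<not> 0 < m"
    then have "V \<subseteq> {0}" using V(2) dim_eq_0 by blast
    then show False using u by auto
  qed
  show ?thesis
  proof (cases rule: hausdorff_measure_subspace_trivial_or_ball[of V m])
    case 1
    moreover have "axis_scale u s ` A \<subseteq> V"
      using A u axis_scale_in_subspace[OF V(1)] by auto
    ultimately show ?thesis using A by simp
  next
    case (2 R)
    have "V \<in> sets borel" using V(1) closed_subspace borel_closed by blast
    then have "hausdorff_measure m (V \<inter> cball 0 R) * c ^ m = hausdorff_measure m (V \<inter> cball 0 R) * ennreal (s ^ m)"
      using power[of "V \<inter> cball 0 R"] by (simp add: mult.commute)
    then have "c ^ m = ennreal (s ^ m)"
      using 2 hausdorff_measure_subspace_cball_less_top[OF V, of R]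
      unfolding ennreal_mult_cancel_left by (metis less_irrefl)
    then have "c = ennreal s"
    proof (cases c)
      case (real r)
      have "ennreal (r ^ m) = ennreal (s ^ m)"
        using \<open>c ^ m = ennreal (s ^ m)\<close> real(2) ennreal_power[OF real(1), of m] by metis
      then have "r ^ m = s ^ m"
        using real(1) s by (metis ennreal_inj less_imp_le zero_le_power)
      then have "r = s" using real(1) s \<open>0 < m\<close> power_eq_imp_eq_base[of r m s] by simp
      then show ?thesis using real(2) by simp
    next
      case top
      then have "c ^ m = top" using \<open>0 < m\<close> by (simp add: top_power_ennreal)
      then show ?thesis using \<open>c ^ m = ennreal (s ^ m)\<close> by (metis ennreal_neq_top)
    qed
    then show ?thesis using c[OF u A] by (simp only:)
  qed
qed

section \<open>Coordinate projections\<close>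

text \<open>Here \<open>w\<close> is the orthogonal projection of \<open>e\<close> on
  \<open>V\<close>, and \<open>u\<close> its direction. By Pythagoras the projection along
  \<open>e\<close> and the dilation along \<open>u\<close> by
  \<open>s = sqrt (1 - (norm w)\<^sup>2)\<close> give the same distances between points of
  \<open>V\<close>.\<close>

lemma hausdorff_measure_orthogonal_projection:
  fixes V :: "'a::euclidean_space set"
  assumes V: "subspace V" "dim V = m" and w: "w \<in> V" "norm w \<le> 1" "\<And>x. x \<in> V \<Longrightarrow> x \<bullet> e = x \<bullet> w"
    and e: "norm e = 1" and A: "A \<in> sets borel" "A \<subseteq> V"
  shows "hausdorff_measure m ((\<lambda>x. x - (x \<bullet> e) *\<^sub>R e) ` A) = ennreal (sqrt (1 - (norm w)\<^sup>2)) * hausdorff_measure m A"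
proof (cases "w = 0")
  case True
  have "(\<lambda>x. x - (x \<bullet> e) *\<^sub>R e) ` A = id ` A"
    using w(3) A(2) True by (intro image_cong) auto
  then show ?thesis using True by simp
next
  case False
  let ?P = "\<lambda>x. x - (x \<bullet> e) *\<^sub>R e"
  define u where "u = w /\<^sub>R norm w"
  define s where "s = sqrt (1 - (norm w)\<^sup>2)"
  have w1: "(norm w)\<^sup>2 \<le> 1" using w(2) by (simp add: power_le_one)
  then have s: "0 \<le> s" "s\<^sup>2 = 1 - (norm w)\<^sup>2" by (simp_all add: s_def)
  have u: "u \<in> V" "norm u = 1"
    using False w V(1) by (auto simp: u_def intro: subspace_scale)
  have wu: "w = norm w *\<^sub>R u" using False by (simp add: u_def)
  have norm_P: "(norm (?P z))\<^sup>2 = (norm z)\<^sup>2 - (norm w)\<^sup>2 * (z \<bullet> u)\<^sup>2" if "z \<in> V" for z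
  proof -
    have "e \<bullet> e = 1" using e by (simp add: dot_square_norm)
    then have "(norm (?P z))\<^sup>2 = (norm z)\<^sup>2 - (z \<bullet> e)\<^sup>2"
      unfolding power2_norm_eq_inner
      by (simp add: inner_diff_left inner_diff_right inner_commute power2_eq_square algebra_simps)
    moreover have "z \<bullet> e = norm w * (z \<bullet> u)" using w(3)[OF that] by (subst (asm) wu) simp
    ultimately show ?thesis by (simp add: power_mult_distrib)
  qed
  have norm_T: "(norm (axis_scale u t z))\<^sup>2 = (norm z)\<^sup>2 + (t\<^sup>2 - 1) * (z \<bullet> u)\<^sup>2" for t z
  proof -
    have "u \<bullet> u = 1" using u by (simp add: dot_square_norm)
    then show ?thesis unfolding power2_norm_eq_inner axis_scale_def
      by (simp add: inner_add_left inner_add_right inner_commute power2_eq_square algebra_simps)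
  qed
  \<comment> \<open>Any \<open>t\<close> above \<open>s\<close> is allowed, because \<open>s\<close>
    may be 0 while the dilation formula requires a positive factor.\<close>
  have dist_le: "dist (?P x) (?P y) \<le> dist (axis_scale u t x) (axis_scale u t y)"
    if "s \<le> t" "x \<in> A" "y \<in> A" for t x y
  proof -
    have z: "x - y \<in> V" using that A V(1) by (auto intro: subspace_diff)
    have "s\<^sup>2 \<le> t\<^sup>2" using that s by (intro power_mono) auto
    then have "- (norm w)\<^sup>2 * ((x - y) \<bullet> u)\<^sup>2 \<le> (t\<^sup>2 - 1) * ((x - y) \<bullet> u)\<^sup>2"
      using s by (intro mult_right_mono) auto
    then have "(norm (?P (x - y)))\<^sup>2 \<le> (norm (axis_scale u t (x - y)))\<^sup>2"
      using norm_P[OF z] norm_T[of t "x - y"] by simp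
    then have "norm (?P (x - y)) \<le> norm (axis_scale u t (x - y))"
      by (rule power2_le_imp_le) simp
    then show ?thesis
      by (simp add: dist_norm linear_diff[OF linear_axis_scale, symmetric] inner_diff_left algebra_simps)
  qed
  have le: "hausdorff_measure m (?P ` C) \<le> ennreal t * hausdorff_measure m C"
    if t: "s \<le> t" "0 < t" and C: "C \<subseteq> A" "C \<in> sets borel" for t C
  proof -
    have "hausdorff_measure m (?P ` C) \<le> hausdorff_measure m (axis_scale u t ` C)"
      using dist_le[OF t(1)] C(1) by (intro hausdorff_measure_image_le_image) auto
    also have "\<dots> = ennreal t * hausdorff_measure m C"
      using C A by (intro hausdorff_measure_axis_scale[OF V t(2) u]) auto
    finally show ?thesis .
  qed
  show ?thesis unfolding s_def[symmetric]
  proof (cases "s = 0")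
    case False
    then have "0 < s" using s by simp
    have "hausdorff_measure m (axis_scale u s ` A) \<le> hausdorff_measure m (?P ` A)"
    proof (rule hausdorff_measure_image_le_image)
      fix x y assume xy: "x \<in> A" "y \<in> A"
      have z: "x - y \<in> V" using xy A V(1) by (auto intro: subspace_diff)
      have "(norm (axis_scale u s (x - y)))\<^sup>2 = (norm (?P (x - y)))\<^sup>2"
        using norm_P[OF z] norm_T[of s "x - y"] s by simp
      then have "norm (axis_scale u s (x - y)) = norm (?P (x - y))"
        by simp
      then show "dist (axis_scale u s x) (axis_scale u s y) \<le> dist (?P x) (?P y)"
        by (simp add: dist_norm linear_diff[OF linear_axis_scale, symmetric] inner_diff_left algebra_simps)
    qed
    then show "hausdorff_measure m (?P ` A) = ennreal s * hausdorff_measure m A"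
      using le[OF order_refl \<open>0 < s\<close> order_refl A(1)] hausdorff_measure_axis_scale[OF V \<open>0 < s\<close> u A]
      by simp
  next
    case True
    have zero: "hausdorff_measure m (?P ` (A \<inter> cball 0 (real R))) = 0" for R :: nat
    proof -
      let ?C = "A \<inter> cball 0 (real R)"
      have "hausdorff_measure m ?C < top"
        using A(2) hausdorff_measure_subspace_cball_less_top[OF V, of "real R"]
          hausdorff_measure_mono[of ?C "V \<inter> cball 0 (real R)" m] by (auto intro: le_less_trans)
      then obtain h where h: "0 \<le> h" "hausdorff_measure m ?C = ennreal h"
        by (auto simp: less_top_ennreal)
      \<comment> \<open>For \<open>s = 0\<close> the factor in \<open>le\<close> can be arbitrarily
        small, so a piece of finite measure \<open>h\<close> has a null image. The denominator
        \<open>h + 1\<close> avoids division by 0.\<close>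
      have "hausdorff_measure m (?P ` ?C) \<le> 0 + ennreal d" if "0 < d" for d
      proof -
        have "hausdorff_measure m (?P ` ?C) \<le> ennreal (d / (h + 1)) * ennreal h"
          using that h A True le[of "d / (h + 1)" ?C] by simp
        also have "\<dots> = ennreal (d * (h / (h + 1)))" using that h by (simp add: ennreal_mult'[symmetric])
        also have "\<dots> \<le> ennreal d" using that h by (intro ennreal_leI mult_left_le) auto
        finally show ?thesis by simp
      qed
      then have "hausdorff_measure m (?P ` ?C) \<le> 0" by (rule ennreal_le_epsilon)
      then show ?thesis by simp
    qed
    have "?P ` A \<subseteq> (\<Union>R::nat. ?P ` (A \<inter> cball 0 (real R)))"
    proof
      fix y assume "y \<in> ?P ` A"
      then obtain x where x: "x \<in> A" "y = ?P x" by blast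
      obtain R :: nat where "norm x \<le> real R" using real_arch_simple by blast
      then have "y \<in> ?P ` (A \<inter> cball 0 (real R))" using x by auto
      then show "y \<in> (\<Union>R::nat. ?P ` (A \<inter> cball 0 (real R)))" by blast
    qed
    then have "hausdorff_measure m (?P ` A) \<le> (\<Sum>R::nat. hausdorff_measure m (?P ` (A \<inter> cball 0 (real R))))"
      by (rule order_trans[OF hausdorff_measure_mono hausdorff_measure_UN_le])
    then show "hausdorff_measure m (?P ` A) = ennreal s * hausdorff_measure m A"
      using True zero by simp
  qed
qed

lemma hausdorff_measure_coord_proj_subspace:
  fixes V :: "(real ^ 'n::finite) set"
  assumes V: "subspace V" "dim V = m" and A: "A \<in> sets borel" "A \<subseteq> V"
  shows "(\<Sum>i\<in>UNIV. (hausdorff_measure m (coord_proj i ` A))\<^sup>2) =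
    ennreal (real CARD('n) - real m) * (hausdorff_measure m A)\<^sup>2"
proof -
  obtain B where B: "B \<subseteq> V" "pairwise orthogonal B" "\<And>x. x \<in> B \<Longrightarrow> norm x = 1"
      "independent B" "card B = dim V" "span B = V"
    using orthonormal_basis_subspace[OF V(1)] by metis
  have fin: "finite B" using B(4) by (rule independent_imp_finite)
  have expand: "(\<Sum>b\<in>B. (x \<bullet> b) *\<^sub>R b) = x" if "x \<in> V" for x
    using orthonormal_basis_expand[OF B(2,3) _ fin] B(6) that by blast
  \<comment> \<open>The orthogonal projection of the \<open>i\<close>th basis vector on
    \<open>V\<close>, expanded in the orthonormal basis \<open>B\<close>.\<close>
  define w where "w i = (\<Sum>b\<in>B. (b $ i) *\<^sub>R b)" for i
  have wV: "w i \<in> V" for i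
    unfolding w_def using B(1) V(1) by (intro subspace_sum subspace_scale) auto
  have inner_w: "x \<bullet> axis i 1 = x \<bullet> w i" if "x \<in> V" for x i
  proof -
    have "x \<bullet> axis i 1 = (\<Sum>b\<in>B. (x \<bullet> b) *\<^sub>R b) $ i" using expand[OF that] by (simp add: inner_axis)
    then show ?thesis by (simp add: w_def inner_sum_right mult.commute)
  qed
  \<comment> \<open>As \<open>w i\<close> lies in \<open>V\<close>, pairing it with itself or with
    the \<open>i\<close>th basis vector gives the same: a diagonal entry of the projection
    matrix.\<close>
  have norm_w: "(norm (w i))\<^sup>2 = w i $ i" for i
    using inner_w[OF wV, of i i] by (simp add: power2_norm_eq_inner inner_axis)
  have w_le: "norm (w i) \<le> 1" for i
  proof -
    have "norm (w i) * norm (w i) \<le> norm (w i) * 1"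
      using norm_w[of i] component_le_norm_cart[of "w i" i] by (simp add: power2_eq_square)
    then show ?thesis by (cases "w i = 0") auto
  qed
  have "(\<Sum>i\<in>UNIV. (norm (w i))\<^sup>2) = (\<Sum>i\<in>UNIV. \<Sum>b\<in>B. (b $ i)\<^sup>2)"
    unfolding norm_w by (simp add: w_def power2_eq_square)
  \<comment> \<open>The trace is computed by exchanging the sums: each unit vector of
    \<open>B\<close> contributes 1.\<close>
  also have "\<dots> = (\<Sum>b\<in>B. (norm b)\<^sup>2)"
    unfolding power2_norm_eq_inner inner_vec_def by (subst sum.swap) (simp add: power2_eq_square)
  also have "\<dots> = real m" using B V(2) by simp
  finally have sum_w: "(\<Sum>i\<in>UNIV. 1 - (norm (w i))\<^sup>2) = real CARD('n) - real m"
    by (simp add: sum_subtractf)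
  have "(hausdorff_measure m (coord_proj i ` A))\<^sup>2 = ennreal (1 - (norm (w i))\<^sup>2) * (hausdorff_measure m A)\<^sup>2" for i
  proof -
    have "hausdorff_measure m (coord_proj i ` A) = ennreal (sqrt (1 - (norm (w i))\<^sup>2)) * hausdorff_measure m A"
      unfolding coord_proj_def
      using inner_w by (intro hausdorff_measure_orthogonal_projection[OF V wV w_le _ _ A]) auto
    then show ?thesis
      using w_le[of i] by (simp add: power_mult_distrib ennreal_power power_le_one)
  qed
  then have "(\<Sum>i\<in>UNIV. (hausdorff_measure m (coord_proj i ` A))\<^sup>2) =
      (\<Sum>i\<in>UNIV. ennreal (1 - (norm (w i))\<^sup>2)) * (hausdorff_measure m A)\<^sup>2"
    by (simp add: sum_distrib_right)
  also have "(\<Sum>i\<in>UNIV. ennreal (1 - (norm (w i))\<^sup>2)) = ennreal (real CARD('n) - real m)"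
    using w_le sum_w by (subst sum_ennreal) (auto simp: power_le_one)
  finally show ?thesis .
qed

theorem proposition2p2:
  fixes A P :: "(real ^ 'n::finite) set" and m :: nat
  assumes "CARD('n) \<ge> 2"
    and "m \<in> {1..CARD('n) - 1}"
    and "A \<in> sets borel"
    and "affine P" and "aff_dim P = int m" and "A \<subseteq> P"
  shows "(hausdorff_measure m A)\<^sup>2 =
           ennreal (1 / (real CARD('n) - real m)) *
           (\<Sum>i\<in>UNIV. (hausdorff_measure m (coord_proj i ` A))\<^sup>2)"
proof -
  have "P \<noteq> {}" using assms(5) by auto
  then obtain a where a: "a \<in> P" by blast
  define V where "V = (\<lambda>x. x - a) ` P"
  define C where "C = (\<lambda>x. x - a) ` A"
  have V: "subspace V" "dim V = m"
    using affine_diffs_subspace_subtract[OF assms(4) a] aff_dim_eq_dim_subtract[OF hull_inc[OF a]] assms(5)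
    by (simp_all add: V_def)
  have "(\<lambda>x. x + a) \<in> borel_measurable borel" by measurable
  from measurable_sets[OF this assms(3)] have "(\<lambda>x. x + a) -` A \<in> sets borel" by simp
  also have "(\<lambda>x. x + a) -` A = C"
    unfolding C_def by (auto intro: image_eqI[where x = "_ + a"])
  finally have C: "C \<in> sets borel" "C \<subseteq> V" using assms(6) by (auto simp: C_def V_def)
  have "hausdorff_measure m C = hausdorff_measure m A"
    unfolding C_def by (rule hausdorff_measure_isometric_image) (simp add: dist_norm)
  \<comment> \<open>Projecting a translate only translates the projection, so the distances
    agree.\<close>
  moreover have "hausdorff_measure m (coord_proj i ` C) = hausdorff_measure m (coord_proj i ` A)" for i
    unfolding C_def image_image
    by (rule hausdorff_measure_image_eq) (simp add: dist_norm coord_proj_def inner_diff_left algebra_simps)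
  ultimately have "(\<Sum>i\<in>UNIV. (hausdorff_measure m (coord_proj i ` A))\<^sup>2) =
      ennreal (real CARD('n) - real m) * (hausdorff_measure m A)\<^sup>2"
    using hausdorff_measure_coord_proj_subspace[OF V C] by simp
  \<comment> \<open>As \<open>m\<close> is less than the dimension, this constant is positive and
    finite, so it cancels even when the measures are infinite.\<close>
  moreover have "ennreal (1 / (real CARD('n) - real m)) * ennreal (real CARD('n) - real m) = 1"
    using assms(1,2) by (subst ennreal_mult'[symmetric]) auto
  ultimately show ?thesis by (simp add: mult.assoc[symmetric])
qed

end
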